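(* Let $s,t$ be positive integers. Consider the following two-player game played on two heaps of finitely many tokens, containing $x$ and $y$ tokens. The players alternate moves; a move is of one of two types: (I) remove any positive number of tokens from a single heap (possibly the entire heap); (II) remove $k>0$ tokens from one heap and $l>0$ tokens from the other, where, writing the two amounts so that $k\le l$, the condition $0<k\le l<sk+t$ holds. The player who makes the last move (after which both heaps are empty) wins. Define sequences $(A_n)_{n\ge 0}$, $(B_n)_{n\ge 0}$ by $$A_n=\operatorname{mex}\{A_i,B_i:0\le i<n\},\qquad B_n=sA_n+tn\qquad(n\ge 0).$$ Then the set of $P$-positions of this game is exactly $\bigcup_{i=0}^{\infty}\{(A_i,B_i)\}$; that is, a position with heap sizes $x\le y$ is a $P$-position if and only if $(x,y)=(A_i,B_i)$ for some $i\ge 0$. *)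

theory Defs
  imports Main
begin

text \<open>Positions are pairs of heap sizes; in rule \<open>two\<close> the smaller removed amount is
  \<open>min k l\<close> and may be taken from either heap.\<close>

inductive game_move :: "nat \<Rightarrow> nat \<Rightarrow> nat \<times> nat \<Rightarrow> nat \<times> nat \<Rightarrow> bool"
  for s t :: nat where
  fst_heap: "0 < k \<Longrightarrow> k \<le> x \<Longrightarrow> game_move s t (x, y) (x - k, y)"
| snd_heap: "0 < k \<Longrightarrow> k \<le> y \<Longrightarrow> game_move s t (x, y) (x, y - k)"
| two: "0 < k \<Longrightarrow> 0 < l \<Longrightarrow> k \<le> x \<Longrightarrow> l \<le> y \<Longrightarrow> max k l < s * min k l + t
    \<Longrightarrow> game_move s t (x, y) (x - k, y - l)"

text \<open>Normal play: a player who cannot move has lost. The previous player (P), respectively the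
  next player (N), can force a win.\<close>

inductive P_position :: "nat \<Rightarrow> nat \<Rightarrow> nat \<times> nat \<Rightarrow> bool"
  and N_position :: "nat \<Rightarrow> nat \<Rightarrow> nat \<times> nat \<Rightarrow> bool"
  for s t :: nat where
  P: "(\<And>q. game_move s t p q \<Longrightarrow> N_position s t q) \<Longrightarrow> P_position s t p"
| N: "game_move s t p q \<Longrightarrow> P_position s t q \<Longrightarrow> N_position s t p"

definition mex :: "nat set \<Rightarrow> nat" where
  "mex S = (LEAST m. m \<notin> S)"

function A_seq :: "nat \<Rightarrow> nat \<Rightarrow> nat \<Rightarrow> nat" and B_seq :: "nat \<Rightarrow> nat \<Rightarrow> nat \<Rightarrow> nat" where
  "A_seq s t n = mex (A_seq s t ` {..<n} \<union> B_seq s t ` {..<n})"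
| "B_seq s t n = s * A_seq s t n + t * n"
  by pat_completeness auto
termination
  by (relation "measures [case_sum (\<lambda>(s, t, n). n) (\<lambda>(s, t, n). n),
                          case_sum (\<lambda>_. 0) (\<lambda>_. 1)]") auto

declare A_seq.simps [simp del] B_seq.simps [simp del]

end

theory Submission
  imports Defs
begin

text \<open>The pairs \<open>(A\<^sub>n, B\<^sub>n)\<close> and their mirror images form a kernel of the move graph. No move joins
  two of them: \<open>A\<close> and \<open>B\<close> are strictly increasing and meet only in \<open>0\<close>, and passing from index
  \<open>i\<close> to \<open>j < i\<close> changes the larger heap by \<open>s (A\<^sub>i - A\<^sub>j) + t (i - j)\<close>, which is just too much.
  Conversely every number is some \<open>A\<^sub>n\<close> or \<open>B\<^sub>n\<close>, and from \<open>(A\<^sub>n, y)\<close> with \<open>A\<^sub>n \<le> y < B\<^sub>n\<close> one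
  reaches \<open>(A\<^sub>m, B\<^sub>m)\<close> where \<open>m\<close> is the quotient of \<open>y - s A\<^sub>n\<close> by \<open>t\<close>.\<close>

section \<open>Mex and the sequences \<open>A\<close> and \<open>B\<close>\<close>

lemma mex_notin: "finite S \<Longrightarrow> mex S \<notin> S"
  unfolding mex_def by (rule LeastI_ex) (rule ex_new_if_finite[OF infinite_UNIV_nat])

lemma mem_if_less_mex: "m < mex S \<Longrightarrow> m \<in> S"
  unfolding mex_def using not_less_Least by blast

lemma mex_mono:
  assumes "finite T" and "S \<subseteq> T"
  shows "mex S \<le> mex T"
proof (rule ccontr)
  assume "\<not> mex S \<le> mex T"
  then have "mex T \<in> S" by (simp add: mem_if_less_mex)
  then show False using assms mex_notin by blast
qed

lemma A_seq_notin_earlier: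
  assumes "i < n"
  shows "A_seq s t n \<noteq> A_seq s t i" and "A_seq s t n \<noteq> B_seq s t i"
proof -
  have "A_seq s t n \<notin> A_seq s t ` {..<n} \<union> B_seq s t ` {..<n}"
    unfolding A_seq.simps[of s t n] by (rule mex_notin) simp
  then show "A_seq s t n \<noteq> A_seq s t i" and "A_seq s t n \<noteq> B_seq s t i"
    using assms by auto
qed

lemma A_seq_less:
  assumes "i < n"
  shows "A_seq s t i < A_seq s t n"
proof -
  have "A_seq s t i \<le> A_seq s t n"
    unfolding A_seq.simps[of s t i] A_seq.simps[of s t n]
    using assms by (intro mex_mono) auto
  then show ?thesis using A_seq_notin_earlier(1)[OF assms, of s t] by simp
qed

lemma A_seq_ge_index: "n \<le> A_seq s t n"
  by (rule strict_mono_imp_increasing) (simp add: strict_mono_def A_seq_less)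

text \<open>A mex larger than \<open>x\<close> certifies that \<open>x\<close> has already been
  used.\<close>

lemma A_seq_or_B_seq_cover: "(\<exists>n. x = A_seq s t n) \<or> (\<exists>n. x = B_seq s t n)"
proof -
  have "x < A_seq s t (Suc x)" using A_seq_ge_index[of "Suc x" s t] by simp
  then have "x \<in> A_seq s t ` {..<Suc x} \<union> B_seq s t ` {..<Suc x}"
    by (subst (asm) A_seq.simps) (rule mem_if_less_mex)
  then show ?thesis by auto
qed

lemma A_seq_0 [simp]: "A_seq s t 0 = 0"
  by (subst A_seq.simps) (simp add: mex_def)

lemma B_seq_0 [simp]: "B_seq s t 0 = 0"
  by (simp add: B_seq.simps)

text \<open>The indices differ by at least 1, so the terms \<open>t * n\<close> alone contribute
  \<open>t\<close>. The left side is the first amount that rule \<open>two\<close> forbids when the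
  smaller removal is the difference of the \<open>A\<close> values.\<close>

lemma B_seq_gap:
  assumes "i < n"
  shows "s * (A_seq s t n - A_seq s t i) + t \<le> B_seq s t n - B_seq s t i"
proof -
  obtain d where d: "A_seq s t n = A_seq s t i + d"
    using A_seq_less[OF assms, of s t] less_imp_add_positive by metis
  obtain e where "n = i + Suc e" using assms less_iff_Suc_add by auto
  then have "B_seq s t n = B_seq s t i + (s * d + t * Suc e)"
    unfolding B_seq.simps d by (simp add: algebra_simps)
  then show ?thesis using d by simp
qed

lemma B_seq_less:
  assumes "t > 0" and "i < n"
  shows "B_seq s t i < B_seq s t n"
  using B_seq_gap[OF assms(2), of s t] assms(1) by linarith

lemma A_seq_le_B_seq: "s > 0 \<Longrightarrow> A_seq s t n \<le> B_seq s t n"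
  by (simp add: B_seq.simps trans_le_add1)

lemma A_seq_eq_iff: "A_seq s t i = A_seq s t j \<longleftrightarrow> i = j"
  by (metis A_seq_less less_irrefl linorder_neqE_nat)

lemma B_seq_eq_iff: "t > 0 \<Longrightarrow> B_seq s t i = B_seq s t j \<longleftrightarrow> i = j"
  by (metis B_seq_less less_irrefl linorder_neqE_nat)

text \<open>The mex rules out \<open>j < i\<close>. Otherwise
  \<open>A\<^sub>i \<le> A\<^sub>j \<le> s A\<^sub>j \<le> B\<^sub>j\<close>, and equality leaves no
  room for \<open>t * j\<close>.\<close>

lemma A_seq_eq_B_seq_iff:
  assumes "s > 0" and "t > 0"
  shows "A_seq s t i = B_seq s t j \<longleftrightarrow> i = 0 \<and> j = 0"
proof
  assume eq: "A_seq s t i = B_seq s t j"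
  then have "i \<le> j" using A_seq_notin_earlier(2)[of j i s t] by (meson not_le)
  then have "A_seq s t i \<le> A_seq s t j"
    using A_seq_less[of i j s t] by (cases "i = j") auto
  moreover have "A_seq s t j \<le> s * A_seq s t j" using assms by simp
  ultimately have "t * j = 0" using eq unfolding B_seq.simps by linarith
  then show "i = 0 \<and> j = 0" using assms \<open>i \<le> j\<close> by simp
qed simp

section \<open>The symmetric set of pairs and the moves into and out of it\<close>

definition AB_pairs :: "nat \<Rightarrow> nat \<Rightarrow> (nat \<times> nat) set" where
  "AB_pairs s t = (\<Union>i. {(A_seq s t i, B_seq s t i), (B_seq s t i, A_seq s t i)})"

lemma mem_AB_pairs_iff:
  "(x, y) \<in> AB_pairs s t \<longleftrightarrow>
    (\<exists>i. x = A_seq s t i \<and> y = B_seq s t i \<or> x = B_seq s t i \<and> y = A_seq s t i)"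
  by (auto simp: AB_pairs_def)

lemma swap_mem_AB_pairs: "(y, x) \<in> AB_pairs s t \<longleftrightarrow> (x, y) \<in> AB_pairs s t"
  by (auto simp: mem_AB_pairs_iff)

lemma ordered_mem_AB_pairs_iff:
  assumes "s > 0" and "x \<le> y"
  shows "(x, y) \<in> AB_pairs s t \<longleftrightarrow> (\<exists>i. (x, y) = (A_seq s t i, B_seq s t i))"
  unfolding mem_AB_pairs_iff using assms A_seq_le_B_seq by (metis le_antisym prod.inject)

lemma game_move_swap:
  assumes "game_move s t (x, y) (x', y')"
  shows "game_move s t (y, x) (y', x')"
  using assms
proof cases
  case (two k l)
  then show ?thesis
    using game_move.two[of l k y x s t] by (simp add: max.commute min.commute)
qed (auto intro: game_move.intros)

lemma no_move_from_AB_to_AB_pairs: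
  assumes "s > 0" and "t > 0"
    and "game_move s t (A_seq s t i, B_seq s t i) (x, y)"
  shows "(x, y) \<notin> AB_pairs s t"
proof
  note eqs = A_seq_eq_iff B_seq_eq_iff[OF assms(2)] A_seq_eq_B_seq_iff[OF assms(1,2)]
    A_seq_eq_B_seq_iff[OF assms(1,2), THEN trans[OF eq_commute]]
  assume "(x, y) \<in> AB_pairs s t"
  then obtain j where j: "x = A_seq s t j \<and> y = B_seq s t j \<or> x = B_seq s t j \<and> y = A_seq s t j"
    by (auto simp: mem_AB_pairs_iff)
  from assms(3) show False
  proof cases
    case (fst_heap k)
    then have "y = B_seq s t i" "x \<noteq> A_seq s t i" by auto
    \<comment> \<open>Sharing one heap forces \<open>i = j\<close>, with both indices 0 if the pair
      is mirrored; then the other heap agrees too.\<close>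
    then show False using j by (auto simp: eqs)
  next
    case (snd_heap k)
    then have "x = A_seq s t i" "y \<noteq> B_seq s t i" by auto
    then show False using j by (auto simp: eqs)
  next
    case (two k l)
    \<comment> \<open>In both orientations \<open>A\<^sub>j \<le> x\<close> and
      \<open>y \<le> B\<^sub>j\<close>, so mirroring only shrinks \<open>k\<close> and enlarges
      \<open>l\<close>.\<close>
    have AB: "A_seq s t j \<le> B_seq s t j" by (rule A_seq_le_B_seq) fact
    have "x < A_seq s t i" using two by auto
    then have "A_seq s t j < A_seq s t i" using j AB by auto
    then have "j < i" by (metis A_seq_less less_asym' linorder_neqE_nat)
    have "k \<le> A_seq s t i - A_seq s t j" using two j AB by auto
    then have "s * k + t \<le> s * (A_seq s t i - A_seq s t j) + t" by simp
    also have "\<dots> \<le> B_seq s t i - B_seq s t j" by (rule B_seq_gap) fact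
    also have "\<dots> \<le> l" using two j AB by auto
    finally have "s * k + t \<le> max k l" by simp
    moreover have "s * min k l \<le> s * k" by simp
    ultimately show False using two by linarith
  qed
qed

text \<open>If \<open>x = B\<^sub>n\<close>, or \<open>x = A\<^sub>n\<close> with \<open>y\<close>
  above \<open>B\<^sub>n\<close>, lowering \<open>y\<close> to the partner of \<open>x\<close>
  suffices. Rule \<open>two\<close> serves the remaining case.\<close>

lemma move_to_AB_pairs_if_ordered:
  assumes "s > 0" and "t > 0" and "x \<le> y" and "(x, y) \<notin> AB_pairs s t"
  shows "\<exists>q \<in> AB_pairs s t. game_move s t (x, y) q"
proof -
  have snd: "game_move s t (x, y) (x, z)" if "z < y" for z
    using snd_heap[of "y - z" y s t x] that by simp
  show ?thesis
  proof (cases "\<exists>n. x = A_seq s t n")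
    case False
    then obtain n where n: "x = B_seq s t n" using A_seq_or_B_seq_cover by blast
    then have "(x, A_seq s t n) \<in> AB_pairs s t" by (auto simp: mem_AB_pairs_iff)
    moreover from this have "A_seq s t n < y"
      using A_seq_le_B_seq[OF assms(1), of t n] n assms(3,4)
      by (metis le_antisym le_trans not_le)
    ultimately show ?thesis using snd by blast
  next
    case True
    then obtain n where n: "x = A_seq s t n" by blast
    then have mem: "(x, B_seq s t n) \<in> AB_pairs s t" by (auto simp: mem_AB_pairs_iff)
    show ?thesis
    proof (cases "B_seq s t n < y")
      case True
      then show ?thesis using mem snd by blast
    next
      case False
      then have y: "y < s * x + t * n"
        using mem assms(4) n by (metis B_seq.simps linorder_neqE_nat)
      \<comment> \<open>Truncated subtraction gives \<open>m = 0\<close>, a move to \<open>(0, 0)\<close>, when \<open>y < s * x\<close>.\<close>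
      define m where "m = (y - s * x) div t"
      have "n > 0" using y assms n by (cases n) auto
      then have "y - s * x < n * t"
        using y assms(2) by (cases "y \<le> s * x") (auto simp: mult.commute less_diff_conv2)
      then have "m < n" using assms(2) by (simp add: m_def div_less_iff_less_mult)
      define k where "k = x - A_seq s t m"
      have k: "0 < k" "x = A_seq s t m + k" using A_seq_less[OF \<open>m < n\<close>, of s t] n by (auto simp: k_def)
      \<comment> \<open>This makes \<open>k\<close> the smaller removal, so the condition of rule
        \<open>two\<close> becomes \<open>l < s * k + t\<close>.\<close>
      have lower: "B_seq s t m + k \<le> y"
      proof (cases "s * x \<le> y")
        case True
        have "t * m \<le> y - s * x" by (simp add: m_def)
        then have "s * x + t * m \<le> y" using True by linarith
        moreover have "s * x = s * A_seq s t m + s * k" by (simp add: k(2) distrib_left)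
        moreover have "k \<le> s * k" using assms by simp
        ultimately show ?thesis unfolding B_seq.simps by linarith
      next
        case False
        then have "m = 0" by (simp add: m_def)
        then show ?thesis using k assms(3) by simp
      qed
      define l where "l = y - B_seq s t m"
      have l: "k \<le> l" "y = B_seq s t m + l" using lower by (auto simp: l_def)
      \<comment> \<open>The remainder modulo \<open>t\<close> is below \<open>t\<close>;
        substituting \<open>x = A\<^sub>m + k\<close> turns this into the upper bound on
        \<open>l\<close>.\<close>
      have "y - s * x < t * m + t"
        using assms(2) by (simp add: m_def) (metis add.commute dividend_less_times_div)
      then have "l < s * k + t"
        using l(2) by (simp add: B_seq.simps k(2) algebra_simps)
      then have "game_move s t (x, y) (x - k, y - l)"
        using k l by (intro two) (auto simp: max_def min_def)
      moreover have "(x - k, y - l) \<in> AB_pairs s t"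
        using k l by (auto simp: mem_AB_pairs_iff)
      ultimately show ?thesis by blast
    qed
  qed
qed

section \<open>Kernels and P-positions\<close>

lemma game_move_decreases: "game_move s t p q \<Longrightarrow> fst q + snd q < fst p + snd p"
  by (induction rule: game_move.induct) auto

text \<open>Every move from \<open>K\<close> leaves it and the opponent can always return, while the
  token count decreases, so play ends.\<close>

lemma P_position_iff_mem_kernel:
  assumes indep: "\<And>p q. p \<in> K \<Longrightarrow> game_move s t p q \<Longrightarrow> q \<notin> K"
    and absorb: "\<And>p. p \<notin> K \<Longrightarrow> \<exists>q \<in> K. game_move s t p q"
  shows "P_position s t p \<longleftrightarrow> p \<in> K"
proof
  show "p \<in> K" if "P_position s t p"
    using that
  \<comment> \<open>The mutual induction carries the companion claim that N-positions lie outside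
    \<open>K\<close>.\<close>
  proof (induction rule: P_position_N_position.inducts(1)[where ?P2.0 = "\<lambda>p. p \<notin> K"])
    case (P p)
    then show ?case using absorb[of p] by blast
  next
    case (N p q)
    then show ?case using indep[of p q] by blast
  qed
next
  \<comment> \<open>Both outcomes are proved together, since rule \<open>P\<close> needs every
    successor to be an N-position.\<close>
  have "if p \<in> K then P_position s t p else N_position s t p"
  proof (induction "fst p + snd p" arbitrary: p rule: less_induct)
    case less
    then have IH: "if q \<in> K then P_position s t q else N_position s t q"
      if "game_move s t p q" for q
      using that game_move_decreases by blast
    show ?case
    proof (cases "p \<in> K")
      case True
      then have "N_position s t q" if "game_move s t p q" for q
        using IH[OF that] indep[OF True that] by simp
      then show ?thesis using True P by simp
    next
      case False
      then obtain q where "q \<in> K" and "game_move s t p q" using absorb by blast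
      then show ?thesis using False IH[of q] N by simp
    qed
  qed
  then show "p \<in> K \<Longrightarrow> P_position s t p" by simp
qed

lemma P_position_iff_mem_AB_pairs:
  assumes "s > 0" and "t > 0"
  shows "P_position s t p \<longleftrightarrow> p \<in> AB_pairs s t"
proof (rule P_position_iff_mem_kernel)
  fix p q assume p: "p \<in> AB_pairs s t" and move: "game_move s t p q"
  obtain x y where q: "q = (x, y)" by fastforce
  from p obtain i where "p = (A_seq s t i, B_seq s t i) \<or> p = (B_seq s t i, A_seq s t i)"
    by (auto simp: AB_pairs_def)
  then show "q \<notin> AB_pairs s t"
    using move no_move_from_AB_to_AB_pairs[OF assms] game_move_swap swap_mem_AB_pairs q by metis
next
  fix p assume p: "p \<notin> AB_pairs s t"
  obtain x y where xy: "p = (x, y)" by fastforce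
  show "\<exists>q \<in> AB_pairs s t. game_move s t p q"
  proof (cases "x \<le> y")
    case True
    then show ?thesis using move_to_AB_pairs_if_ordered[OF assms] p xy by blast
  next
    case False
    then obtain a b where "(a, b) \<in> AB_pairs s t" "game_move s t (y, x) (a, b)"
      using move_to_AB_pairs_if_ordered[OF assms, of y x] p xy swap_mem_AB_pairs by fastforce
    then show ?thesis using game_move_swap swap_mem_AB_pairs xy by blast
  qed
qed

theorem theorem1:
  fixes s t :: nat
  assumes "s > 0" and "t > 0"
  shows "{(x, y). x \<le> y \<and> P_position s t (x, y)} = (\<Union>i. {(A_seq s t i, B_seq s t i)})
    \<and> (\<forall>x y. x \<le> y \<longrightarrow>
         (P_position s t (x, y) \<longleftrightarrow> (\<exists>i. (x, y) = (A_seq s t i, B_seq s t i))) \<and>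
         (P_position s t (y, x) \<longleftrightarrow> (\<exists>i. (x, y) = (A_seq s t i, B_seq s t i))))"
proof -
  have ordered: "P_position s t (x, y) \<longleftrightarrow> (\<exists>i. (x, y) = (A_seq s t i, B_seq s t i))"
    "P_position s t (y, x) \<longleftrightarrow> (\<exists>i. (x, y) = (A_seq s t i, B_seq s t i))" if "x \<le> y" for x y
    unfolding P_position_iff_mem_AB_pairs[OF assms] swap_mem_AB_pairs[of y x]
    by (rule ordered_mem_AB_pairs_iff[OF assms(1) that])+
  \<comment> \<open>On the right, \<open>x \<le> y\<close> follows from
    \<open>A_seq_le_B_seq\<close>.\<close>
  have "(x \<le> y \<and> P_position s t (x, y)) \<longleftrightarrow> (\<exists>i. (x, y) = (A_seq s t i, B_seq s t i))" for x y
    using ordered(1)[of x y] A_seq_le_B_seq[OF assms(1), of t] by auto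
  then have "{(x, y). x \<le> y \<and> P_position s t (x, y)} = (\<Union>i. {(A_seq s t i, B_seq s t i)})"
    by auto
  then show ?thesis using ordered by simp
qed

end
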